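(* Let $A\in\mathrm{GL}_{n}(\mathbb{Z})$ and let $G=\mathbb{Z}^{n}\rtimes_{A}\mathbb{Z}$, where a generator of $\mathbb{Z}$ acts on $\mathbb{Z}^{n}$ via $A$. Let $l:G\to[0,\infty)$ be a length function. Then the restriction of $l$ to $\mathbb{Z}^{n}$ extends to a continuous function $l:\mathbb{R}^{n}\to[0,\infty)$ satisfying: (1) $l(r_{1}+r_{2})\leq l(r_{1})+l(r_{2})$ for all $r_{1},r_{2}\in\mathbb{R}^{n}$; (2) $l(ar)=|a|\,l(r)$ for all $a\in\mathbb{R}$, $r\in\mathbb{R}^{n}$; (3) $l(Ar)=l(r)$ for all $r\in\mathbb{R}^{n}$.
   Context: A length function on a group $G$ is a function $l:G\to[0,\infty)$ such that $l(g^{n})=|n|\,l(g)$ for all $g\in G,n\in\mathbb{Z}$; $l(hgh^{-1})=l(g)$ for all $g,h$; and $l(ab)\leq l(a)+l(b)$ whenever $a,b$ commute. *)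

theory Defs
  imports "HOL-Analysis.Analysis" "HOL-Algebra.Group"
begin

text \<open>Integer powers A^k (k in Z) of a matrix A in GL_n(Z); for k < 0 the power of the
  (integer) inverse matrix is used.\<close>
definition mat_ipow :: "int^'n^'n \<Rightarrow> int \<Rightarrow> int^'n^'n" where
  "mat_ipow A k =
     (if 0 \<le> k then (((**) A) ^^ nat k) (mat 1)
      else (((**) (matrix_inv A)) ^^ nat (- k)) (mat 1))"

text \<open>The semidirect product Z^n \<rtimes>_A Z: (v,k)(w,m) = (v + A^k w, k + m),
  so that the generator t = (0,1) of Z acts by t v t^-1 = A v.\<close>
definition sdp :: "int^'n^'n \<Rightarrow> ((int^'n) \<times> int) monoid" where
  "sdp A = \<lparr> carrier = UNIV,
             mult = (\<lambda>(v, k) (w, m). (v + mat_ipow A k *v w, k + m)),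
             one = (0, 0) \<rparr>"

text \<open>Length function on a group G (with values in [0,\<infinity>)).\<close>
definition length_function :: "('a, 'b) monoid_scheme \<Rightarrow> ('a \<Rightarrow> real) \<Rightarrow> bool" where
  "length_function G l \<longleftrightarrow>
     (\<forall>g\<in>carrier G. 0 \<le> l g) \<and>
     (\<forall>g\<in>carrier G. \<forall>n::int. l (g [^]\<^bsub>G\<^esub> n) = \<bar>real_of_int n\<bar> * l g) \<and>
     (\<forall>g\<in>carrier G. \<forall>h\<in>carrier G.
        l (h \<otimes>\<^bsub>G\<^esub> g \<otimes>\<^bsub>G\<^esub> inv\<^bsub>G\<^esub> h) = l g) \<and>
     (\<forall>a\<in>carrier G. \<forall>b\<in>carrier G.
        a \<otimes>\<^bsub>G\<^esub> b = b \<otimes>\<^bsub>G\<^esub> a \<longrightarrow> l (a \<otimes>\<^bsub>G\<^esub> b) \<le> l a + l b)"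

definition real_vec :: "int^'n \<Rightarrow> real^'n" where
  "real_vec v = (\<chi> i. real_of_int (v $ i))"

definition real_mat :: "int^'n^'n \<Rightarrow> real^'n^'n" where
  "real_mat A = (\<chi> i j. real_of_int (A $ i $ j))"

end

theory Submission
  imports Defs
begin

(*
  Restricted to the translations, a length function l gives g v = l (v, 0), which is subadditive
  (Z^n is abelian), homogeneous under integer scalars, and A-invariant (conjugation by the
  generator of Z acts as A). Such a g is coarsely Lipschitz: |g u - g w| <= C * max_i |u_i - w_i|,
  where C is the sum of its values on the unit vectors. Hence g (floor (k r)) / k converges with
  rate C / k, and its limit, the stable norm L, satisfies |g (floor (k r)) - k L r| <= C for all k.
  Every required property of L is an approximate property of k \<mapsto> g (floor (k r)) with an error
  bounded independently of k; dividing by k and letting k grow makes it exact.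
*)

definition floor_vec :: "real^'n \<Rightarrow> int^'n" where
  "floor_vec r = (\<chi> i. \<lfloor>r$i\<rfloor>)"

lemma floor_vec_nth [simp]: "floor_vec r $ i = \<lfloor>r$i\<rfloor>"
  by (simp add: floor_vec_def)

lemma floor_vec_zero [simp]: "floor_vec 0 = 0"
  by (simp add: vec_eq_iff)

lemma le_if_nat_mult_le_plus_const:
  fixes x y D :: real
  assumes "\<And>k::nat. real k * x \<le> real k * y + D"
  shows "x \<le> y"
proof (rule ccontr)
  assume "\<not> x \<le> y"
  then obtain k :: nat where "D < real k * (x - y)"
    using ex_less_of_nat_mult[of "x - y" D] by auto
  with assms[of k] show False
    by (simp add: algebra_simps)
qed

lemma eq_if_nat_mult_dist_le_const:
  fixes x y D :: real
  assumes "\<And>k::nat. \<bar>real k * x - real k * y\<bar> \<le> D"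
  shows "x = y"
proof (rule antisym)
  have "real k * x \<le> real k * y + D" "real k * y \<le> real k * x + D" for k
    using assms[of k] by (simp_all add: abs_le_iff)
  then show "x \<le> y" "y \<le> x"
    by (blast intro: le_if_nat_mult_le_plus_const)+
qed

lemma lim_dist_le_const_over_n:
  fixes f :: "nat \<Rightarrow> real"
  assumes dist_le: "\<And>m n. 1 \<le> m \<Longrightarrow> 1 \<le> n \<Longrightarrow> \<bar>f m - f n\<bar> \<le> C / m + C / n"
    and "1 \<le> k"
  shows "\<bar>f k - lim f\<bar> \<le> C / k"
proof -
  define x where "x = (SUP m\<in>{1..}. f m - C / m)"
  have "bdd_above ((\<lambda>m. f m - C / m) ` {1..})"
    using dist_le[of _ 1] by (intro bdd_aboveI2[of _ _ "f 1 + C"]) (force simp: abs_le_iff)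
  then have below: "f m - C / m \<le> x" if "1 \<le> m" for m
    unfolding x_def using that by (intro cSUP_upper) auto
  have above: "x \<le> f m + C / m" if "1 \<le> m" for m
    unfolding x_def using that dist_le by (intro cSUP_least) (force simp: abs_le_iff)+
  have close: "\<bar>f m - x\<bar> \<le> C / m" if "1 \<le> m" for m
    using below[OF that] above[OF that] by (simp add: abs_le_iff)
  have "(\<lambda>m. f m - x) \<longlonglongrightarrow> 0"
    using close by (intro Lim_null_comparison[OF _ lim_const_over_n[of C]])
      (auto intro: eventually_sequentiallyI[of 1])
  then have "lim f = x"
    by (simp add: LIM_zero_iff limI)
  then show ?thesis
    using close assms(2) by simp
qed

lemma real_mat_mult_floor_vec_dist:
  "\<bar>(real_mat A *v x) $ i - real_of_int ((A *v floor_vec x) $ i)\<bar> \<le> (\<Sum>j\<in>UNIV. \<bar>real_of_int (A$i$j)\<bar>)"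
proof -
  have "(real_mat A *v x) $ i - real_of_int ((A *v floor_vec x) $ i)
          = (\<Sum>j\<in>UNIV. real_of_int (A$i$j) * (x$j - \<lfloor>x$j\<rfloor>))"
    by (simp add: matrix_vector_mult_def real_mat_def sum_subtractf[symmetric] algebra_simps)
  also have "\<bar>\<dots>\<bar> \<le> (\<Sum>j\<in>UNIV. \<bar>real_of_int (A$i$j) * (x$j - \<lfloor>x$j\<rfloor>)\<bar>)"
    by (rule sum_abs)
  also have "\<dots> \<le> (\<Sum>j\<in>UNIV. \<bar>real_of_int (A$i$j)\<bar>)"
  proof (rule sum_mono)
    fix j
    have "\<bar>x$j - \<lfloor>x$j\<rfloor>\<bar> \<le> 1"
      by linarith
    then show "\<bar>real_of_int (A$i$j) * (x$j - \<lfloor>x$j\<rfloor>)\<bar> \<le> \<bar>real_of_int (A$i$j)\<bar>"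
      by (simp add: abs_mult mult_left_le)
  qed
  finally show ?thesis .
qed

locale lattice_seminorm =
  fixes g :: "int^'n \<Rightarrow> real"
  assumes subadditive: "\<And>v w. g (v + w) \<le> g v + g w"
    and homogeneous: "\<And>k v. g (k *s v) = \<bar>real_of_int k\<bar> * g v"
begin

lemma zero [simp]: "g 0 = 0"
  using homogeneous[of 0 0] by simp

lemma minus [simp]: "g (- v) = g v"
  using homogeneous[of "-1" v] by (simp add: vector_sneg_minus1)

lemma nonneg: "0 \<le> g v"
  using subadditive[of v "- v"] by simp

lemma sum_le: "g (sum f S) \<le> (\<Sum>x\<in>S. g (f x))"
proof (induction S rule: infinite_finite_induct)
  case (insert x S)
  then show ?case
    using subadditive[of "f x" "sum f S"] by simp
qed simp_all

definition axis_bound :: real where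
  "axis_bound = (\<Sum>i\<in>UNIV. g (axis i 1))"

lemma axis_bound_nonneg: "0 \<le> axis_bound"
  unfolding axis_bound_def by (simp add: nonneg sum_nonneg)

lemma le_axis_bound:
  assumes "\<And>i. \<bar>real_of_int (v$i)\<bar> \<le> B"
  shows "g v \<le> axis_bound * B"
proof -
  have "v = (\<Sum>i\<in>UNIV. (v$i) *s axis i 1)"
    by (simp add: vec_eq_iff axis_def if_distrib cong: if_cong)
  then have "g v \<le> (\<Sum>i\<in>UNIV. g ((v$i) *s axis i 1))"
    by (metis sum_le)
  also have "\<dots> = (\<Sum>i\<in>UNIV. \<bar>real_of_int (v$i)\<bar> * g (axis i 1))"
    by (simp add: homogeneous)
  also have "\<dots> \<le> (\<Sum>i\<in>UNIV. B * g (axis i 1))"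
    using assms nonneg by (intro sum_mono mult_right_mono) auto
  also have "\<dots> = axis_bound * B"
    by (simp add: axis_bound_def sum_distrib_left mult.commute)
  finally show ?thesis .
qed

lemma dist_le_axis_bound:
  assumes "\<And>i. \<bar>real_of_int (u$i) - real_of_int (w$i)\<bar> \<le> B"
  shows "\<bar>g u - g w\<bar> \<le> axis_bound * B"
proof -
  have "g (u - w) \<le> axis_bound * B"
    using assms by (intro le_axis_bound) simp
  moreover have "g u \<le> g w + g (u - w)" "g w \<le> g u + g (u - w)"
    using subadditive[of w "u - w"] subadditive[of u "w - u"] minus[of "u - w"] by simp_all
  ultimately show ?thesis
    by linarith
qed

definition stable_norm :: "real^'n \<Rightarrow> real" where
  "stable_norm r = lim (\<lambda>k. g (floor_vec (real k *\<^sub>R r)) / real k)"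

lemma floor_vec_multiples_dist:
  "\<bar>real m * g (floor_vec (real k *\<^sub>R r)) - real k * g (floor_vec (real m *\<^sub>R r))\<bar>
     \<le> axis_bound * (real k + real m)"
proof -
  have "\<bar>g (int m *s floor_vec (real k *\<^sub>R r)) - g (int k *s floor_vec (real m *\<^sub>R r))\<bar>
          \<le> axis_bound * (real k + real m)"
  proof (rule dist_le_axis_bound)
    fix i
    have "real m * real_of_int \<lfloor>real k * r$i\<rfloor> \<in> {real m * (real k * r$i - 1) .. real m * (real k * r$i)}"
         "real k * real_of_int \<lfloor>real m * r$i\<rfloor> \<in> {real k * (real m * r$i - 1) .. real k * (real m * r$i)}"
      by (auto intro!: mult_left_mono)
    then show "\<bar>real_of_int ((int m *s floor_vec (real k *\<^sub>R r)) $ i)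
                - real_of_int ((int k *s floor_vec (real m *\<^sub>R r)) $ i)\<bar> \<le> real k + real m"
      by (simp add: algebra_simps abs_le_iff)
  qed
  then show ?thesis
    by (simp add: homogeneous)
qed

lemma stable_norm_approx:
  "\<bar>g (floor_vec (real k *\<^sub>R r)) - real k * stable_norm r\<bar> \<le> axis_bound"
proof (cases "k = 0")
  case True
  then show ?thesis
    by (simp add: axis_bound_nonneg)
next
  case False
  let ?f = "\<lambda>k. g (floor_vec (real k *\<^sub>R r)) / real k"
  have "\<bar>?f m - ?f n\<bar> \<le> axis_bound / m + axis_bound / n" if "1 \<le> m" "1 \<le> n" for m n
  proof -
    have "\<bar>?f m - ?f n\<bar> = \<bar>real n * g (floor_vec (real m *\<^sub>R r)) - real m * g (floor_vec (real n *\<^sub>R r))\<bar> / (real m * real n)"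
      using that by (simp add: field_simps abs_divide)
    also have "\<dots> \<le> axis_bound * (real m + real n) / (real m * real n)"
      by (intro divide_right_mono floor_vec_multiples_dist) simp
    also have "\<dots> = axis_bound / m + axis_bound / n"
      using that by (simp add: field_simps)
    finally show ?thesis .
  qed
  then have "\<bar>?f k - stable_norm r\<bar> \<le> axis_bound / k"
    unfolding stable_norm_def using False by (intro lim_dist_le_const_over_n) auto
  then have "real k * \<bar>?f k - stable_norm r\<bar> \<le> axis_bound"
    using False by (simp add: field_simps)
  then show ?thesis
    using False by (simp add: field_simps flip: abs_mult_pos)
qed

lemma stable_norm_real_vec: "stable_norm (real_vec v) = g v"
proof (rule eq_if_nat_mult_dist_le_const)
  fix k :: nat
  have "floor_vec (real k *\<^sub>R real_vec v) = int k *s v"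
    by (simp add: vec_eq_iff real_vec_def) (metis floor_of_int of_int_mult of_int_of_nat_eq)
  then show "\<bar>real k * stable_norm (real_vec v) - real k * g v\<bar> \<le> axis_bound"
    using stable_norm_approx[of k "real_vec v"] by (simp add: homogeneous abs_minus_commute)
qed

lemma stable_norm_nonneg: "0 \<le> stable_norm r"
proof (rule le_if_nat_mult_le_plus_const[of _ _ axis_bound])
  fix k :: nat
  show "real k * 0 \<le> real k * stable_norm r + axis_bound"
    using stable_norm_approx[of k r] nonneg[of "floor_vec (real k *\<^sub>R r)"] by (simp add: abs_le_iff)
qed

lemma stable_norm_triangle: "stable_norm (r + s) \<le> stable_norm r + stable_norm s"
proof (rule le_if_nat_mult_le_plus_const[of _ _ "5 * axis_bound"])
  fix k :: nat
  have "\<bar>g (floor_vec (real k *\<^sub>R (r + s))) - g (floor_vec (real k *\<^sub>R r) + floor_vec (real k *\<^sub>R s))\<bar>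
          \<le> axis_bound * 2"
    by (rule dist_le_axis_bound) (simp add: distrib_left abs_le_iff; linarith)
  then show "real k * stable_norm (r + s) \<le> real k * (stable_norm r + stable_norm s) + 5 * axis_bound"
    using stable_norm_approx[of k "r + s"] stable_norm_approx[of k r] stable_norm_approx[of k s]
      subadditive[of "floor_vec (real k *\<^sub>R r)" "floor_vec (real k *\<^sub>R s)"]
    by (simp add: abs_le_iff algebra_simps)
qed

lemma stable_norm_le_norm: "stable_norm r \<le> axis_bound * norm r"
proof (rule le_if_nat_mult_le_plus_const[of _ _ "2 * axis_bound"])
  fix k :: nat
  have "g (floor_vec (real k *\<^sub>R r)) \<le> axis_bound * (real k * norm r + 1)"
  proof (rule le_axis_bound)
    fix i
    have "\<bar>real k * r$i\<bar> \<le> real k * norm r"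
      by (simp add: abs_mult mult_left_mono component_le_norm_cart)
    then show "\<bar>real_of_int (floor_vec (real k *\<^sub>R r) $ i)\<bar> \<le> real k * norm r + 1"
      by (simp add: abs_le_iff) linarith
  qed
  then show "real k * stable_norm r \<le> real k * (axis_bound * norm r) + 2 * axis_bound"
    using stable_norm_approx[of k r] by (simp add: abs_le_iff algebra_simps)
qed

lemma stable_norm_lipschitz: "axis_bound-lipschitz_on UNIV stable_norm"
proof (rule lipschitz_onI)
  fix r s :: "real^'n"
  have "stable_norm r \<le> stable_norm s + axis_bound * norm (r - s)"
       "stable_norm s \<le> stable_norm r + axis_bound * norm (r - s)"
    using stable_norm_triangle[of s "r - s"] stable_norm_triangle[of r "s - r"]
      stable_norm_le_norm[of "r - s"] stable_norm_le_norm[of "s - r"]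
    by (simp_all add: norm_minus_commute)
  then show "dist (stable_norm r) (stable_norm s) \<le> axis_bound * dist r s"
    by (simp add: dist_real_def dist_norm abs_le_iff)
qed (rule axis_bound_nonneg)

lemma stable_norm_minus: "stable_norm (- r) = stable_norm r"
proof (rule eq_if_nat_mult_dist_le_const[of _ _ "4 * axis_bound"])
  fix k :: nat
  have "\<bar>g (floor_vec (real k *\<^sub>R (- r))) - g (- floor_vec (real k *\<^sub>R r))\<bar> \<le> axis_bound * 2"
    by (rule dist_le_axis_bound) (simp add: abs_le_iff; linarith)
  then show "\<bar>real k * stable_norm (- r) - real k * stable_norm r\<bar> \<le> 4 * axis_bound"
    using stable_norm_approx[of k r] stable_norm_approx[of k "- r"] by (simp add: abs_le_iff)
qed

lemma stable_norm_scaleR_nonneg: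
  assumes "0 \<le> c"
  shows "stable_norm (c *\<^sub>R r) = c * stable_norm r"
proof (rule eq_if_nat_mult_dist_le_const[of _ _ "axis_bound * (norm r + 3) + stable_norm r"])
  fix k :: nat
  \<comment> \<open>the k-th approximation of c r is compared with the m-th approximation of r\<close>
  define m where "m = nat \<lfloor>real k * c\<rfloor>"
  have "real m = real_of_int \<lfloor>real k * c\<rfloor>"
    using assms by (simp add: m_def)
  then have m: "real m \<le> real k * c" "real k * c < real m + 1"
    by linarith+
  have "\<bar>g (floor_vec (real k *\<^sub>R (c *\<^sub>R r))) - g (floor_vec (real m *\<^sub>R r))\<bar> \<le> axis_bound * (norm r + 1)"
  proof (rule dist_le_axis_bound)
    fix i
    have "\<bar>real k * c * r$i - real m * r$i\<bar> = \<bar>real k * c - real m\<bar> * \<bar>r$i\<bar>"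
      by (simp add: left_diff_distrib flip: abs_mult)
    also have "\<dots> \<le> 1 * norm r"
      using m by (intro mult_mono component_le_norm_cart) auto
    finally show "\<bar>real_of_int (floor_vec (real k *\<^sub>R (c *\<^sub>R r)) $ i) - real_of_int (floor_vec (real m *\<^sub>R r) $ i)\<bar>
                    \<le> norm r + 1"
      by (simp add: abs_le_iff mult.assoc) linarith
  qed
  moreover have "\<bar>real m * stable_norm r - real k * c * stable_norm r\<bar> \<le> 1 * stable_norm r"
    using m stable_norm_nonneg[of r]
    by (simp add: abs_mult mult_left_le_one_le flip: left_diff_distrib)
  ultimately show "\<bar>real k * stable_norm (c *\<^sub>R r) - real k * (c * stable_norm r)\<bar>
                     \<le> axis_bound * (norm r + 3) + stable_norm r"
    using stable_norm_approx[of k "c *\<^sub>R r"] stable_norm_approx[of m r]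
    by (simp add: abs_le_iff algebra_simps)
qed

lemma stable_norm_scaleR: "stable_norm (c *\<^sub>R r) = \<bar>c\<bar> * stable_norm r"
  using stable_norm_scaleR_nonneg[of c r] stable_norm_scaleR_nonneg[of "- c" r] stable_norm_minus[of "c *\<^sub>R r"]
  by (cases "0 \<le> c") simp_all

lemma stable_norm_matrix_invariant:
  assumes "\<And>v. g (A *v v) = g v"
  shows "stable_norm (real_mat A *v r) = stable_norm r"
proof -
  define M where "M = (\<Sum>i\<in>UNIV. \<Sum>j\<in>UNIV. \<bar>real_of_int (A$i$j)\<bar>)"
  have row_le: "(\<Sum>j\<in>UNIV. \<bar>real_of_int (A$i$j)\<bar>) \<le> M" for i
    unfolding M_def by (rule member_le_sum) (auto intro: sum_nonneg)
  show ?thesis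
  proof (rule eq_if_nat_mult_dist_le_const[of _ _ "axis_bound * (M + 3)"])
    fix k :: nat
    have "\<bar>g (floor_vec (real k *\<^sub>R (real_mat A *v r))) - g (A *v floor_vec (real k *\<^sub>R r))\<bar>
            \<le> axis_bound * (M + 1)"
    proof (rule dist_le_axis_bound)
      fix i
      have "\<bar>(real_mat A *v (real k *\<^sub>R r)) $ i - real_of_int ((A *v floor_vec (real k *\<^sub>R r)) $ i)\<bar> \<le> M"
        using real_mat_mult_floor_vec_dist row_le by (rule order_trans)
      then show "\<bar>real_of_int (floor_vec (real k *\<^sub>R (real_mat A *v r)) $ i)
                  - real_of_int ((A *v floor_vec (real k *\<^sub>R r)) $ i)\<bar> \<le> M + 1"
        by (simp add: matrix_vector_mult_scaleR abs_le_iff) linarith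
    qed
    then show "\<bar>real k * stable_norm (real_mat A *v r) - real k * stable_norm r\<bar> \<le> axis_bound * (M + 3)"
      using stable_norm_approx[of k "real_mat A *v r"] stable_norm_approx[of k r]
        assms[of "floor_vec (real k *\<^sub>R r)"]
      by (simp add: abs_le_iff algebra_simps)
  qed
qed

end

lemma sdp_mult [simp]: "(v, k) \<otimes>\<^bsub>sdp A\<^esub> (w, m) = (v + mat_ipow A k *v w, k + m)"
  by (simp add: sdp_def)

lemma sdp_one [simp]: "\<one>\<^bsub>sdp A\<^esub> = (0, 0)"
  by (simp add: sdp_def)

lemma carrier_sdp [simp]: "carrier (sdp A) = UNIV"
  by (simp add: sdp_def)

lemma mat_ipow_0 [simp]: "mat_ipow A 0 = mat 1"
  by (simp add: mat_ipow_def)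

lemma mat_ipow_1 [simp]: "mat_ipow A 1 = A"
  by (simp add: mat_ipow_def matrix_mul_rid)

lemma sdp_inv_eqI:
  assumes "x \<otimes>\<^bsub>sdp A\<^esub> y = (0, 0)" "y \<otimes>\<^bsub>sdp A\<^esub> x = (0, 0)"
    and "\<And>z. x \<otimes>\<^bsub>sdp A\<^esub> z = (0, 0) \<Longrightarrow> z = y"
  shows "inv\<^bsub>sdp A\<^esub> x = y"
  unfolding m_inv_def
proof (rule the_equality)
  show "y \<in> carrier (sdp A) \<and> x \<otimes>\<^bsub>sdp A\<^esub> y = \<one>\<^bsub>sdp A\<^esub> \<and> y \<otimes>\<^bsub>sdp A\<^esub> x = \<one>\<^bsub>sdp A\<^esub>"
    using assms(1,2) by simp
  show "z = y" if "z \<in> carrier (sdp A) \<and> x \<otimes>\<^bsub>sdp A\<^esub> z = \<one>\<^bsub>sdp A\<^esub> \<and> z \<otimes>\<^bsub>sdp A\<^esub> x = \<one>\<^bsub>sdp A\<^esub>" for z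
    using that assms(3) by simp
qed

lemma sdp_inv_translation: "inv\<^bsub>sdp A\<^esub> (v, 0) = (- v, 0)"
  by (rule sdp_inv_eqI) (auto simp: add_eq_0_iff)

lemma sdp_inv_generator:
  assumes "invertible A"
  shows "inv\<^bsub>sdp A\<^esub> (0, 1) = (0, - 1)"
proof (rule sdp_inv_eqI)
  fix z
  assume "(0, 1) \<otimes>\<^bsub>sdp A\<^esub> z = (0, 0)"
  moreover obtain w m where "z = (w, m)"
    by fastforce
  ultimately have "A *v w = 0" "m = - 1"
    by simp_all
  moreover obtain B where "B ** A = mat 1"
    using assms unfolding invertible_def by blast
  ultimately show "z = (0, - 1)"
    using \<open>z = (w, m)\<close> by (metis matrix_vector_mul_assoc matrix_vector_mul_lid matrix_vector_mult_0_right)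
qed simp_all

lemma sdp_int_pow_translation: "(v, 0) [^]\<^bsub>sdp A\<^esub> (k::int) = (k *s v, 0)"
proof -
  have nat_pow: "(v, 0) [^]\<^bsub>sdp A\<^esub> (n::nat) = (int n *s v, 0)" for n
    by (induction n) (simp_all add: vec_eq_iff algebra_simps)
  show ?thesis
    by (simp add: int_pow_def2 nat_pow sdp_inv_translation vec_eq_iff)
qed

lemma lattice_seminorm_length_function:
  fixes A :: "int^'n^'n"
  assumes "length_function (sdp A) l"
  shows "lattice_seminorm (\<lambda>v. l (v, 0))"
proof
  fix v w :: "int^'n" and k :: int
  note lf = assms[unfolded length_function_def carrier_sdp]
  have "(v, 0) \<otimes>\<^bsub>sdp A\<^esub> (w, 0) = (w, 0) \<otimes>\<^bsub>sdp A\<^esub> (v, 0)"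
    by (simp add: add.commute)
  then have "l ((v, 0) \<otimes>\<^bsub>sdp A\<^esub> (w, 0)) \<le> l (v, 0) + l (w, 0)"
    using lf by blast
  then show "l (v + w, 0) \<le> l (v, 0) + l (w, 0)"
    by simp
  have "l ((v, 0) [^]\<^bsub>sdp A\<^esub> k) = \<bar>real_of_int k\<bar> * l (v, 0)"
    using lf by blast
  then show "l (k *s v, 0) = \<bar>real_of_int k\<bar> * l (v, 0)"
    by (simp add: sdp_int_pow_translation)
qed

lemma length_function_sdp_matrix_invariant:
  assumes "invertible A" "length_function (sdp A) l"
  shows "l (A *v v, 0) = l (v, 0)"
proof -
  have "(0, 1) \<otimes>\<^bsub>sdp A\<^esub> (v, 0) \<otimes>\<^bsub>sdp A\<^esub> inv\<^bsub>sdp A\<^esub> (0, 1) = (A *v v, 0)"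
    by (simp add: sdp_inv_generator[OF assms(1)])
  moreover have "l ((0, 1) \<otimes>\<^bsub>sdp A\<^esub> (v, 0) \<otimes>\<^bsub>sdp A\<^esub> inv\<^bsub>sdp A\<^esub> (0, 1)) = l (v, 0)"
    using assms(2) unfolding length_function_def carrier_sdp by blast
  ultimately show ?thesis
    by simp
qed

theorem lemma6:
  fixes A :: "int^'n^'n" and l :: "(int^'n) \<times> int \<Rightarrow> real"
  assumes "invertible A"
    and "length_function (sdp A) l"
  shows "\<exists>L :: real^'n \<Rightarrow> real.
           continuous_on UNIV L \<and>
           (\<forall>r. 0 \<le> L r) \<and>
           (\<forall>v. L (real_vec v) = l (v, 0)) \<and>
           (\<forall>r1 r2. L (r1 + r2) \<le> L r1 + L r2) \<and>
           (\<forall>a r. L (a *\<^sub>R r) = \<bar>a\<bar> * L r) \<and>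
           (\<forall>r. L (real_mat A *v r) = L r)"
proof -
  interpret lattice_seminorm "\<lambda>v. l (v, 0)"
    using assms(2) by (rule lattice_seminorm_length_function)
  have "stable_norm (real_mat A *v r) = stable_norm r" for r
    using length_function_sdp_matrix_invariant[OF assms] by (rule stable_norm_matrix_invariant)
  then show ?thesis
    using lipschitz_on_continuous_on[OF stable_norm_lipschitz]
    by (intro exI[of _ stable_norm])
      (simp add: stable_norm_nonneg stable_norm_real_vec stable_norm_triangle stable_norm_scaleR)
qed

end
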